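(* Let $K$ be a field, $X=K^2$ (row vectors), $Y=M_{2,1}(K)$ (column vectors), and let $\mathcal{R}=\left[\begin{array}{cc} K & X \\ Y & M_2(K) \end{array}\right]$ be the $K$-algebra with multiplication $$\left[\begin{array}{cc} \alpha & x \\ y & f \end{array}\right]\left[\begin{array}{cc} \alpha' & x' \\ y' & f' \end{array}\right]=\left[\begin{array}{cc} \alpha\alpha' & \alpha x'+xf' \\ \alpha'y+fy' & ff' \end{array}\right].$$ For $x_1\in K^2$, $y_1\in M_{2,1}(K)$, $\lambda\in K^\times$, $P\in GL_2(K)$ define $\varphi_{x_1,y_1,\lambda,P}:\mathcal{R}\to\mathcal{R}$ by $$\varphi_{x_1,y_1,\lambda,P}\left(\left[\begin{array}{cc} \alpha & x \\ y & f \end{array}\right]\right)=\left[\begin{array}{cc} \alpha & \alpha x_1+\lambda xP^{-1}-x_1PfP^{-1} \\ \alpha y_1+Py-PfP^{-1}y_1 & PfP^{-1} \end{array}\right].$$ Then $\varphi_{x_1,y_1,\lambda,P}$ is an algebra automorphism of $\mathcal{R}$ for all $x_1\in K^2$, $y_1\in M_{2,1}(K)$, $\lambda\in K^\times$, $P\in GL_2(K)$, and the map $$\Phi:(K^2\times M_{2,1}(K))\rtimes(K^\times\times GL_2(K))\to\mathrm{Aut}(\mathcal{R}),\qquad\Phi(x_1,y_1,\lambda,P)=\varphi_{x_1,y_1,\lambda,P}$$ is an isomorphism of groups. An automorphism $\varphi_{x_1,y_1,\lambda,P}$ of $\mathcal{R}$ is inner if and only if $\lambda=1$. As a consequence, $\mathrm{Out}(\mathcal{R})\simeq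 K^\times$.
   Context: The semidirect product is formed with respect to the action of the multiplicative group $K^\times\times GL_2(K)$ on the additive group $K^2\times M_{2,1}(K)$ given by $(\lambda,P)\cdot(x_1,y_1)=(\lambda x_1P^{-1},Py_1)$. Thus $(x_1',y_1',\lambda',P')(x_1,y_1,\lambda,P)=(x_1'+\lambda'x_1P'^{-1},\,y_1'+P'y_1,\,\lambda'\lambda,\,P'P)$. $\mathrm{Aut}(\mathcal{R})$ is the group of $K$-algebra automorphisms under composition; an automorphism is inner if it has the form $r\mapsto u^{-1}ru$ with $u\in\mathcal{R}$ invertible; $\mathrm{Out}(\mathcal{R})$ is the quotient of $\mathrm{Aut}(\mathcal{R})$ by the inner automorphisms. *)

theory Defs
  imports "HOL-Analysis.Analysis" "HOL-Algebra.Algebra"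
begin

section \<open>Automorphisms of an associative unital algebra over a field\<close>

locale assoc_algebra = vector_space smul
  for smul :: "'k::field \<Rightarrow> 'a::ring_1 \<Rightarrow> 'a" +
  assumes smul_mult_left: "smul c r * s = smul c (r * s)"
    and smul_mult_right: "r * smul c s = smul c (r * s)"

definition algebra_automorphism :: "('k::field \<Rightarrow> 'a::ring_1 \<Rightarrow> 'a) \<Rightarrow> ('a \<Rightarrow> 'a) \<Rightarrow> bool" where
  "algebra_automorphism smul g \<longleftrightarrow>
     bij g \<and> Vector_Spaces.linear smul smul g \<and> g 1 = 1 \<and> (\<forall>r s. g (r * s) = g r * g s)"

definition Aut_algebra :: "('k::field \<Rightarrow> 'a::ring_1 \<Rightarrow> 'a) \<Rightarrow> ('a \<Rightarrow> 'a) monoid" where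
  "Aut_algebra smul = \<lparr>carrier = {g. algebra_automorphism smul g}, mult = (\<circ>), one = id\<rparr>"

definition inner_automorphisms :: "('a::ring_1 \<Rightarrow> 'a) set" where
  "inner_automorphisms = {\<lambda>r. v * r * u | u v. u * v = 1 \<and> v * u = 1}"

definition Out_algebra :: "('k::field \<Rightarrow> 'a::ring_1 \<Rightarrow> 'a) \<Rightarrow> ('a \<Rightarrow> 'a) set monoid" where
  "Out_algebra smul = Aut_algebra smul Mod inner_automorphisms"

context assoc_algebra
begin

lemma linear_iff_ops:
  "Vector_Spaces.linear smul smul g \<longleftrightarrow>
     (\<forall>r s. g (r + s) = g r + g s) \<and> (\<forall>c r. g (smul c r) = smul c (g r))"
  by (simp add: Vector_Spaces.linear_def module_hom_def module_hom_axioms_def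
      vector_space_axioms module_axioms)

lemma group_Aut_algebra: "group (Aut_algebra smul)"
proof (rule groupI)
  fix g assume "g \<in> carrier (Aut_algebra smul)"
  then have g: "bij g" "\<And>r s. g (r + s) = g r + g s" "\<And>c r. g (smul c r) = smul c (g r)"
    "g 1 = 1" "\<And>r s. g (r * s) = g r * g s"
    by (auto simp: Aut_algebra_def algebra_automorphism_def linear_iff_ops)
  let ?h = "inv_into UNIV g"
  have gh: "g (?h r) = r" for r
    using g(1) by (simp add: bij_is_surj surj_f_inv_f)
  have inj: "?h r = s \<longleftrightarrow> r = g s" for r s
    using g(1) by (metis bij_inv_eq_iff)
  have "?h \<in> carrier (Aut_algebra smul)"
    using g(1) by (auto simp: Aut_algebra_def algebra_automorphism_def linear_iff_ops inj gh g
        bij_imp_bij_inv)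
  moreover have "?h \<circ> g = id"
    using g(1) by (simp add: bij_is_inj)
  ultimately show "\<exists>h\<in>carrier (Aut_algebra smul). h \<otimes>\<^bsub>Aut_algebra smul\<^esub> g = \<one>\<^bsub>Aut_algebra smul\<^esub>"
    by (auto simp: Aut_algebra_def)
qed (auto simp: Aut_algebra_def algebra_automorphism_def linear_iff_ops bij_comp comp_assoc)

lemma inner_automorphisms_normal: "inner_automorphisms \<lhd> Aut_algebra smul"
proof -
  interpret A: group "Aut_algebra smul" by (rule group_Aut_algebra)
  have aut: "algebra_automorphism smul (\<lambda>r. v * r * u)" if uv: "u * v = 1" "v * u = 1" for u v
  proof -
    have e: "v * (u * r * v) * u = r" "u * (v * r * u) * v = r" for r
      using uv by (metis mult.assoc mult_1_left mult_1_right)+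
    have "bij (\<lambda>r. v * r * u)"
      by (rule bij_betw_byWitness[where f' = "\<lambda>r. u * r * v"]) (auto simp: e)
    moreover have "v * (r * s) * u = (v * r * u) * (v * s * u)" for r s
      using uv by (metis mult.assoc mult_1_left)
    ultimately show ?thesis
      using uv by (simp add: algebra_automorphism_def linear_iff_ops distrib_left distrib_right
          smul_mult_left smul_mult_right)
  qed
  show ?thesis
    unfolding A.normal_inv_iff
  proof (intro conjI ballI)
    show "subgroup inner_automorphisms (Aut_algebra smul)"
    proof (rule A.subgroupI)
      show "inner_automorphisms \<subseteq> carrier (Aut_algebra smul)"
        using aut by (auto simp: inner_automorphisms_def Aut_algebra_def)
      have "(\<lambda>r. 1 * r * 1) \<in> inner_automorphisms"
        unfolding inner_automorphisms_def by (intro CollectI exI[of _ 1]) simp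
      then show "inner_automorphisms \<noteq> {}" by blast
    next
      fix g :: "'a \<Rightarrow> 'a" assume "g \<in> inner_automorphisms"
      then obtain u v where uv: "u * v = 1" "v * u = 1" "g = (\<lambda>r. v * r * u)"
        by (auto simp: inner_automorphisms_def)
      have "inv\<^bsub>Aut_algebra smul\<^esub> g = (\<lambda>r. u * r * v)"
      proof (rule A.inv_equality)
        show "(\<lambda>r. u * r * v) \<otimes>\<^bsub>Aut_algebra smul\<^esub> g = \<one>\<^bsub>Aut_algebra smul\<^esub>"
          using uv(1,2) by (auto simp: Aut_algebra_def uv(3) fun_eq_iff) (metis mult.assoc mult_1_left mult_1_right)
      qed (use aut uv in \<open>auto simp: Aut_algebra_def\<close>)
      then show "inv\<^bsub>Aut_algebra smul\<^esub> g \<in> inner_automorphisms"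
        using uv by (auto simp: inner_automorphisms_def)
    next
      fix g h :: "'a \<Rightarrow> 'a" assume "g \<in> inner_automorphisms" "h \<in> inner_automorphisms"
      then obtain u v u' v' where uv: "u * v = 1" "v * u = 1" "g = (\<lambda>r. v * r * u)"
        "u' * v' = 1" "v' * u' = 1" "h = (\<lambda>r. v' * r * u')"
        by (auto simp: inner_automorphisms_def)
      have "g \<circ> h = (\<lambda>r. (v * v') * r * (u' * u))" 
        by (simp add: uv fun_eq_iff mult.assoc)
      moreover have "(u' * u) * (v * v') = 1" "(v * v') * (u' * u) = 1"
        using uv by (metis mult.assoc mult_1_left)+
      ultimately show "g \<otimes>\<^bsub>Aut_algebra smul\<^esub> h \<in> inner_automorphisms"
        by (auto simp: inner_automorphisms_def Aut_algebra_def)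
    qed
  next
    fix g h :: "'a \<Rightarrow> 'a" assume gc: "g \<in> carrier (Aut_algebra smul)" and "h \<in> inner_automorphisms"
    then obtain u v where uv: "u * v = 1" "v * u = 1" "h = (\<lambda>r. v * r * u)"
      by (auto simp: inner_automorphisms_def)
    let ?k = "inv\<^bsub>Aut_algebra smul\<^esub> g"
    have gm: "g 1 = 1" "\<And>r s. g (r * s) = g r * g s"
      using gc by (auto simp: Aut_algebra_def algebra_automorphism_def)
    have "g \<circ> ?k = id"
      using A.r_inv[OF gc] by (simp add: Aut_algebra_def)
    then have "g (?k r) = r" for r by (metis comp_apply id_apply)
    then have "g \<circ> h \<circ> ?k = (\<lambda>r. g v * r * g u)"
      by (simp add: uv fun_eq_iff gm)
    moreover have "g u * g v = 1" "g v * g u = 1"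
      using gm uv by metis+
    ultimately show "g \<otimes>\<^bsub>Aut_algebra smul\<^esub> h \<otimes>\<^bsub>Aut_algebra smul\<^esub> ?k \<in> inner_automorphisms"
      by (auto simp: inner_automorphisms_def Aut_algebra_def)
  qed
qed

lemma group_Out_algebra: "group (Out_algebra smul)"
  unfolding Out_algebra_def using inner_automorphisms_normal by (rule normal.factorgroup_is_group)

end


section \<open>The algebra of block matrices\<close>

text \<open>
  Both rows and columns are represented by \<open>'k^2\<close>: a row is multiplied by matrices from the
  right with \<open>v*\<close>, a column from the left with \<open>*v\<close>.
  \<open>Blk \<alpha> x y f\<close> is the matrix with rows \<open>(\<alpha>, x)\<close> and \<open>(y, f)\<close>.
  In the multiplication the products of \<open>x\<close>-entries with \<open>y\<close>-entries are zero in both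
  diagonal blocks, so this is not the algebra of \<open>3 \<times> 3\<close> matrices.
\<close>

datatype 'k blk = Blk 'k "'k^2" "'k^2" "'k^2^2"

instantiation blk :: (field) ring_1
begin

definition zero_blk :: "'a blk" where "0 = Blk 0 0 0 0"

definition one_blk :: "'a blk" where "1 = Blk 1 0 0 (mat 1)"

fun plus_blk :: "'a blk \<Rightarrow> 'a blk \<Rightarrow> 'a blk" where
  "Blk \<alpha> x y f + Blk \<alpha>' x' y' f' = Blk (\<alpha> + \<alpha>') (x + x') (y + y') (f + f')"

fun minus_blk :: "'a blk \<Rightarrow> 'a blk \<Rightarrow> 'a blk" where
  "Blk \<alpha> x y f - Blk \<alpha>' x' y' f' = Blk (\<alpha> - \<alpha>') (x - x') (y - y') (f - f')"

fun uminus_blk :: "'a blk \<Rightarrow> 'a blk" where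
  "- Blk \<alpha> x y f = Blk (- \<alpha>) (- x) (- y) (- f)"

fun times_blk :: "'a blk \<Rightarrow> 'a blk \<Rightarrow> 'a blk" where
  "Blk \<alpha> x y f * Blk \<alpha>' x' y' f' =
     Blk (\<alpha> * \<alpha>') (\<alpha> *s x' + x v* f') (\<alpha>' *s y + f *v y') (f ** f')"

instance
proof
  fix r s t :: "'a blk"
  show "r * s * t = r * (s * t)"
    by (cases r; cases s; cases t)
      (simp add: vec_eq_iff forall_2 vector_matrix_mult_def matrix_vector_mult_def
        matrix_matrix_mult_def sum_2 algebra_simps)
  show "1 * r = r" "r * 1 = r"
    by (cases r; simp add: one_blk_def vec_eq_iff forall_2 vector_matrix_mult_def
        matrix_vector_mult_def matrix_matrix_mult_def sum_2 mat_def)+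
  show "(r + s) * t = r * t + s * t" "r * (s + t) = r * s + r * t"
    by (cases r; cases s; cases t; simp add: vec_eq_iff forall_2 vector_matrix_mult_def
        matrix_vector_mult_def matrix_matrix_mult_def sum_2 algebra_simps)+
  show "r + s + t = r + (s + t)"
    by (cases r; cases s; cases t) (simp add: add.assoc)
  show "r + s = s + r"
    by (cases r; cases s) (simp add: add.commute)
  show "r - s = r + - s"
    by (cases r; cases s) simp
  show "0 + r = r" "- r + r = 0"
    by (cases r; simp add: zero_blk_def)+
  show "(0 :: 'a blk) \<noteq> 1"
    by (simp add: zero_blk_def one_blk_def)
qed

end

fun scale_blk :: "'k::field \<Rightarrow> 'k blk \<Rightarrow> 'k blk" where
  "scale_blk c (Blk \<alpha> x y f) = Blk (c * \<alpha>) (c *s x) (c *s y) (\<chi> i. c *s (f $ i))"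

interpretation blk: assoc_algebra scale_blk
proof
  fix a b :: 'a and r s :: "'a blk"
  show "scale_blk a (r + s) = scale_blk a r + scale_blk a s"
    by (cases r; cases s) (simp add: vec_eq_iff algebra_simps)
  show "scale_blk (a + b) r = scale_blk a r + scale_blk b r"
    by (cases r) (simp add: vec_eq_iff algebra_simps)
  show "scale_blk a (scale_blk b r) = scale_blk (a * b) r"
    by (cases r) (simp add: vec_eq_iff algebra_simps)
  show "scale_blk 1 r = r"
    by (cases r) (simp add: vec_eq_iff)
  show "scale_blk a r * s = scale_blk a (r * s)" "r * scale_blk a s = scale_blk a (r * s)"
    by (cases r; cases s; simp add: vec_eq_iff forall_2 vector_matrix_mult_def
        matrix_vector_mult_def matrix_matrix_mult_def sum_2 algebra_simps)+
qed


section \<open>The groups involved\<close>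

definition additive_group :: "'a::ab_group_add monoid" where
  "additive_group = \<lparr>carrier = UNIV, mult = (+), one = 0\<rparr>"

definition mult_group :: "'k::field monoid" where
  "mult_group = \<lparr>carrier = {c. c \<noteq> 0}, mult = (*), one = 1\<rparr>"

definition GL2 :: "('k::field^2^2) monoid" where
  "GL2 = \<lparr>carrier = {P. invertible P}, mult = (**), one = mat 1\<rparr>"

definition semidirect_product ::
    "'n monoid \<Rightarrow> 'h monoid \<Rightarrow> ('h \<Rightarrow> 'n \<Rightarrow> 'n) \<Rightarrow> ('n \<times> 'h) monoid" where
  "semidirect_product N H \<theta> =
     \<lparr>carrier = carrier N \<times> carrier H,
      mult = (\<lambda>(n', h') (n, h). (n' \<otimes>\<^bsub>N\<^esub> \<theta> h' n, h' \<otimes>\<^bsub>H\<^esub> h)),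
      one = (\<one>\<^bsub>N\<^esub>, \<one>\<^bsub>H\<^esub>)\<rparr>"

fun param_action :: "'k::field \<times> ('k^2^2) \<Rightarrow> ('k^2) \<times> ('k^2) \<Rightarrow> ('k^2) \<times> ('k^2)" where
  "param_action (l, P) (x1, y1) = (l *s (x1 v* matrix_inv P), P *v y1)"

definition param_group :: "((('k::field^2) \<times> ('k^2)) \<times> ('k \<times> ('k^2^2))) monoid" where
  "param_group =
     semidirect_product (additive_group \<times>\<times> additive_group) (mult_group \<times>\<times> GL2) param_action"

fun phi :: "'k::field^2 \<Rightarrow> 'k^2 \<Rightarrow> 'k \<Rightarrow> 'k^2^2 \<Rightarrow> 'k blk \<Rightarrow> 'k blk" where
  "phi x1 y1 l P (Blk \<alpha> x y f) =
     Blk \<alpha>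
         (\<alpha> *s x1 + l *s (x v* matrix_inv P) - x1 v* (P ** f ** matrix_inv P))
         (\<alpha> *s y1 + P *v y - (P ** f ** matrix_inv P) *v y1)
         (P ** f ** matrix_inv P)"

fun Phi :: "(('k::field^2) \<times> ('k^2)) \<times> ('k \<times> ('k^2^2)) \<Rightarrow> 'k blk \<Rightarrow> 'k blk" where
  "Phi ((x1, y1), (l, P)) = phi x1 y1 l P"

lemma group_additive_group: "group (additive_group :: 'a::ab_group_add monoid)"
proof (rule groupI)
  fix x :: 'a
  show "\<exists>y\<in>carrier additive_group. y \<otimes>\<^bsub>additive_group\<^esub> x = \<one>\<^bsub>additive_group\<^esub>"
    by (rule bexI[of _ "- x"]) (auto simp: additive_group_def)
qed (auto simp: additive_group_def add.assoc)

lemma group_mult_group: "group (mult_group :: 'k::field monoid)"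
proof (rule groupI)
  fix c :: 'k assume "c \<in> carrier mult_group"
  then show "\<exists>d\<in>carrier mult_group. d \<otimes>\<^bsub>mult_group\<^esub> c = \<one>\<^bsub>mult_group\<^esub>"
    by (intro bexI[of _ "inverse c"]) (auto simp: mult_group_def)
qed (auto simp: mult_group_def)

lemma invertible_matrix_inv:
  fixes P :: "'k::field^'n^'n"
  assumes "invertible P"
  shows "P ** matrix_inv P = mat 1" "matrix_inv P ** P = mat 1" "invertible (matrix_inv P)"
  using assms someI_ex[of "\<lambda>Q. P ** Q = mat 1 \<and> Q ** P = mat 1"]
  by (auto simp: invertible_def matrix_inv_def)

lemma invertible_mult_field:
  fixes P Q :: "'k::field^'n^'n"
  assumes "invertible P" "invertible Q"
  shows "invertible (P ** Q)" "matrix_inv (P ** Q) = matrix_inv Q ** matrix_inv P"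
proof -
  have 1: "(P ** Q) ** (matrix_inv Q ** matrix_inv P) = mat 1"
    by (metis assms invertible_matrix_inv(1) matrix_mul_assoc matrix_mul_rid)
  have 2: "(matrix_inv Q ** matrix_inv P) ** (P ** Q) = mat 1"
    by (metis assms invertible_matrix_inv(2) matrix_mul_assoc matrix_mul_rid)
  show 3: "invertible (P ** Q)" using 1 2 by (auto simp: invertible_def)
  show "matrix_inv (P ** Q) = matrix_inv Q ** matrix_inv P"
    by (metis 1 3 invertible_matrix_inv(2) matrix_mul_assoc matrix_mul_lid matrix_mul_rid)
qed

lemma group_GL2: "group (GL2 :: ('k::field^2^2) monoid)"
proof (rule groupI)
  fix P :: "'k^2^2" assume "P \<in> carrier GL2"
  then show "\<exists>Q\<in>carrier GL2. Q \<otimes>\<^bsub>GL2\<^esub> P = \<one>\<^bsub>GL2\<^esub>"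
    by (intro bexI[of _ "matrix_inv P"]) (auto simp: GL2_def invertible_matrix_inv)
next
  show "\<one>\<^bsub>GL2\<^esub> \<in> carrier (GL2 :: ('k^2^2) monoid)"
    by (auto simp: GL2_def invertible_def intro: exI[of _ "mat 1"])
qed (auto simp: GL2_def invertible_mult_field matrix_mul_assoc)

lemma group_semidirect_product:
  assumes N: "group N" and H: "group H"
    and hom: "\<And>h. h \<in> carrier H \<Longrightarrow> \<theta> h \<in> hom N N"
    and one: "\<And>n. n \<in> carrier N \<Longrightarrow> \<theta> \<one>\<^bsub>H\<^esub> n = n"
    and mult: "\<And>h h' n. \<lbrakk>h \<in> carrier H; h' \<in> carrier H; n \<in> carrier N\<rbrakk>
        \<Longrightarrow> \<theta> (h \<otimes>\<^bsub>H\<^esub> h') n = \<theta> h (\<theta> h' n)"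
  shows "group (semidirect_product N H \<theta>)"
proof -
  interpret N: group N by fact
  interpret H: group H by fact
  have cl: "\<theta> h n \<in> carrier N" if "h \<in> carrier H" "n \<in> carrier N" for h n
    using hom that by (auto simp: hom_def)
  have dist: "\<theta> h (n \<otimes>\<^bsub>N\<^esub> n') = \<theta> h n \<otimes>\<^bsub>N\<^esub> \<theta> h n'"
    if "h \<in> carrier H" "n \<in> carrier N" "n' \<in> carrier N" for h n n'
    using hom that by (auto simp: hom_def)
  have oneN: "\<theta> h \<one>\<^bsub>N\<^esub> = \<one>\<^bsub>N\<^esub>" if "h \<in> carrier H" for h
    using hom_one[OF hom[OF that] N N] .
  show ?thesis
  proof (rule groupI)
    fix p assume "p \<in> carrier (semidirect_product N H \<theta>)"
    then obtain n h where p: "p = (n, h)" "n \<in> carrier N" "h \<in> carrier H"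
      by (auto simp: semidirect_product_def)
    let ?q = "(\<theta> (inv\<^bsub>H\<^esub> h) (inv\<^bsub>N\<^esub> n), inv\<^bsub>H\<^esub> h)"
    show "\<exists>q\<in>carrier (semidirect_product N H \<theta>).
        q \<otimes>\<^bsub>semidirect_product N H \<theta>\<^esub> p = \<one>\<^bsub>semidirect_product N H \<theta>\<^esub>"
      using p by (intro bexI[of _ ?q]) (auto simp: semidirect_product_def cl oneN dist[symmetric])
  qed (auto simp: semidirect_product_def cl dist one mult N.m_assoc H.m_assoc)
qed

lemma group_param_group: "group (param_group :: ((('k::field^2) \<times> ('k^2)) \<times> ('k \<times> ('k^2^2))) monoid)"
  unfolding param_group_def
proof (rule group_semidirect_product)
  fix h :: "'k \<times> ('k^2^2)" assume "h \<in> carrier ((mult_group :: 'k monoid) \<times>\<times> GL2)"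
  show "param_action h \<in> hom (additive_group \<times>\<times> additive_group) (additive_group \<times>\<times> additive_group)"
    by (cases h) (auto simp: hom_def additive_group_def DirProd_def vec_eq_iff forall_2
        vector_matrix_mult_def matrix_vector_mult_def sum_2 algebra_simps)
next
  have mi: "matrix_inv (mat 1 :: 'k^2^2) = mat 1"
    using invertible_matrix_inv(1)[of "mat 1 :: 'k^2^2"] by (force simp: invertible_def)
  fix n :: "('k^2) \<times> ('k^2)"
  show "param_action \<one>\<^bsub>(mult_group :: 'k monoid) \<times>\<times> (GL2 :: ('k^2^2) monoid)\<^esub> n = n"
    by (cases n) (simp add: DirProd_def mult_group_def GL2_def mi)
next
  fix h h' :: "'k \<times> ('k^2^2)" and n :: "('k^2) \<times> ('k^2)"
  assume "h \<in> carrier ((mult_group :: 'k monoid) \<times>\<times> GL2)"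
    "h' \<in> carrier ((mult_group :: 'k monoid) \<times>\<times> GL2)"
  then show "param_action (h \<otimes>\<^bsub>(mult_group :: 'k monoid) \<times>\<times> GL2\<^esub> h') n = param_action h (param_action h' n)"
    by (cases h; cases h'; cases n)
      (simp add: DirProd_def mult_group_def GL2_def invertible_mult_field(2),
       simp add: vec_eq_iff forall_2 vector_matrix_mult_def matrix_vector_mult_def
        matrix_matrix_mult_def sum_2 algebra_simps)
qed (auto intro: DirProd_group group_additive_group group_mult_group group_GL2)

end

theory Submission
  imports Defs
begin

text \<open>
  The radical consists of the matrices with zero diagonal blocks, and an automorphism acts on the
  quotient \<open>K \<times> M\<^sub>2(K)\<close> by ring automorphisms, so it maps the central idempotent \<open>e = (1, 0)\<close> to one of
  the two non-trivial central idempotents; since the matrix block contains a nilpotent outside the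
  radical, it fixes \<open>e\<close> modulo the radical. Hence, up to an automorphism \<open>\<phi>\<close> with \<open>\<lambda> = 1\<close>, \<open>P = 1\<close>, it
  fixes \<open>e\<close> itself and therefore acts on each of the four blocks separately. If it is
  \<open>y \<mapsto> P y\<close> on columns and \<open>x \<mapsto> x Q\<close> on rows, multiplicativity forces \<open>f \<mapsto> P f P\<^sup>-\<^sup>1\<close> on the matrix
  block and makes \<open>Q P\<close> central, so \<open>Q = \<lambda> P\<^sup>-\<^sup>1\<close>.
\<close>

section \<open>The automorphisms of the family\<close>

lemmas matrix_distribs =
  vector_matrix_mul_assoc matrix_vector_mul_assoc matrix_mul_assoc
  vector_matrix_left_distrib vector_matrix_mult_diff_distrib
  vector_matrix_mult_add_rdistrib vector_matrix_mult_diff_rdistrib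
  matrix_vector_right_distrib matrix_vector_mult_diff_distrib
  matrix_vector_mult_add_rdistrib matrix_vector_mult_diff_rdistrib
  scalar_vector_matrix_assoc vector_scalar_commute

text \<open>The leading factor \<open>A\<close> is there because \<open>matrix_distribs\<close>
  nests products to the left, so that \<open>P ** matrix_inv P\<close> need not occur as a
  subterm.\<close>

lemma matrix_inv_cancel:
  fixes P :: "'k::field^'n^'n" and A :: "'k^'n^'m"
  assumes "invertible P"
  shows "A ** P ** matrix_inv P = A" "A ** matrix_inv P ** P = A"
  by (metis assms invertible_matrix_inv(1,2) matrix_mul_assoc matrix_mul_rid)+

lemma invertible_mat_1: "invertible (mat 1 :: 'k::field^'n^'n)"
  by (auto simp: invertible_def)

lemma matrix_inv_mat_1: "matrix_inv (mat 1 :: 'k::field^'n^'n) = mat 1"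
  using invertible_matrix_inv(1)[OF invertible_mat_1] by simp

lemma mat_mult_vector:
  fixes c :: "'k::field" and x :: "'k^'n"
  shows "mat c *v x = c *s x" "x v* mat c = c *s x"
  by (simp_all add: vec_eq_iff matrix_vector_mult_def vector_matrix_mult_def mat_def
      if_distrib if_distribR sum.delta sum.delta' mult.commute cong: if_cong)

lemma vector_matrix_eqI:
  fixes A B :: "'k::field^'n^'m"
  assumes "\<And>x. x v* A = x v* B"
  shows "A = B"
proof -
  have "transpose A = transpose B" unfolding matrix_eq by (simp add: assms)
  then show ?thesis by (metis transpose_transpose)
qed

text \<open>Write F and F' for the conjugates by \<open>P\<close> of the matrix blocks of the two
  factors. In the product of the images, the row contains \<alpha> x1 F' and the column \<alpha>' F
  y1, each twice with opposite signs. These cancel, and the image of the product remains.\<close>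

lemma phi_mult:
  fixes P :: "'k::field^2^2"
  assumes "invertible P"
  shows "phi x1 y1 l P (r * s) = phi x1 y1 l P r * phi x1 y1 l P s"
  by (cases r; cases s)
    (simp add: matrix_distribs matrix_inv_cancel assms invertible_matrix_inv vector_ssub_ldistrib vector_add_ldistrib vector_smult_assoc
      mult.commute)

lemma phi_add: "phi x1 y1 l P (r + s) = phi x1 y1 l P r + phi x1 y1 l P s"
  by (cases r; cases s)
    (simp add: vec_eq_iff forall_2 vector_matrix_mult_def matrix_vector_mult_def
        matrix_matrix_mult_def sum_2 algebra_simps)

lemma phi_scale: "phi x1 y1 l P (scale_blk c r) = scale_blk c (phi x1 y1 l P r)"
  by (cases r)
    (simp add: vec_eq_iff forall_2 vector_matrix_mult_def matrix_vector_mult_def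
        matrix_matrix_mult_def sum_2 algebra_simps)

lemma phi_unit: "invertible P \<Longrightarrow> phi x1 y1 l P 1 = 1"
  by (simp add: one_blk_def invertible_matrix_inv)

text \<open>The parameters on the right are those of the product in \<open>param_group\<close>; this
  is the homomorphism property of \<open>Phi\<close> in coordinates.\<close>

lemma phi_comp:
  assumes "invertible P" "invertible P'"
  shows "phi x1' y1' l' P' (phi x1 y1 l P r) =
    phi (x1' + l' *s (x1 v* matrix_inv P')) (y1' + P' *v y1) (l' * l) (P' ** P) r"
  by (cases r)
    (simp add: matrix_distribs matrix_inv_cancel assms invertible_matrix_inv invertible_mult_field vector_ssub_ldistrib vector_add_ldistrib
      vector_smult_assoc mult.commute)

lemma phi_id: "phi 0 0 1 (mat 1) r = r"
  by (cases r) (simp add: matrix_inv_mat_1)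

section \<open>The homomorphism \<open>Phi\<close> and its injectivity\<close>

lemma carrier_param_group:
  "((x1, y1), (l, P)) \<in> carrier param_group \<longleftrightarrow> l \<noteq> 0 \<and> invertible P"
  by (auto simp: param_group_def semidirect_product_def DirProd_def additive_group_def
      mult_group_def GL2_def)

lemma mult_param_group:
  "((x1', y1'), (l', P')) \<otimes>\<^bsub>param_group\<^esub> ((x1, y1), (l, P)) =
    ((x1' + l' *s (x1 v* matrix_inv P'), y1' + P' *v y1), (l' * l, P' ** P))"
  by (auto simp: param_group_def semidirect_product_def DirProd_def additive_group_def
      mult_group_def GL2_def)

lemma one_param_group: "\<one>\<^bsub>param_group\<^esub> = ((0, 0), (1, mat 1))"
  by (auto simp: param_group_def semidirect_product_def DirProd_def additive_group_def
      mult_group_def GL2_def)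

lemma Phi_mult:
  assumes "p \<in> carrier param_group" "q \<in> carrier param_group"
  shows "Phi (p \<otimes>\<^bsub>param_group\<^esub> q) = Phi p \<circ> Phi q"
proof -
  obtain x y l P where p: "p = ((x, y), (l, P))" by (metis surj_pair)
  obtain x' y' l' P' where q: "q = ((x', y'), (l', P'))" by (metis surj_pair)
  show ?thesis
    using assms unfolding p q carrier_param_group mult_param_group
    by (simp add: fun_eq_iff phi_comp)
qed

lemma Phi_one: "Phi \<one>\<^bsub>param_group\<^esub> = id"
  by (simp add: fun_eq_iff one_param_group phi_id)

text \<open>Gives bijectivity of every map in the family from inverses in the parameter group,
  without a formula for the inverse map.\<close>

lemma Phi_inv:
  assumes "p \<in> carrier param_group"
  shows "Phi p \<circ> Phi (inv\<^bsub>param_group\<^esub> p) = id" "Phi (inv\<^bsub>param_group\<^esub> p) \<circ> Phi p = id"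
proof -
  interpret G: group param_group by (rule group_param_group)
  show "Phi p \<circ> Phi (inv\<^bsub>param_group\<^esub> p) = id" "Phi (inv\<^bsub>param_group\<^esub> p) \<circ> Phi p = id"
    using assms by (simp_all flip: Phi_mult add: Phi_one)
qed

lemma Phi_automorphism:
  assumes "p \<in> carrier param_group"
  shows "algebra_automorphism scale_blk (Phi p)"
proof -
  have "bij (Phi p)" using Phi_inv[OF assms] by (blast intro: o_bij)
  moreover obtain x y l P where p: "p = ((x, y), (l, P))" by (metis surj_pair)
  ultimately show ?thesis
    using assms unfolding p carrier_param_group
    by (simp add: algebra_automorphism_def blk.linear_iff_ops phi_add phi_mult phi_scale phi_unit)
qed

lemma Phi_hom: "Phi \<in> hom param_group (Aut_algebra scale_blk)"
  by (rule homI) (simp_all add: Aut_algebra_def Phi_automorphism Phi_mult)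

lemma scalar_eqI:
  fixes a b :: "'k::field"
  assumes "\<And>x :: 'k^'n. a *s x = b *s x"
  shows "a = b"
  using assms[of 1] by (simp add: vec_eq_iff)

text \<open>Single values reveal the parameters: the idempotent with corner 1 gives \<open>x\<close>
  and \<open>y\<close>, the columns give \<open>P\<close>, and then the rows give
  \<open>l\<close>.\<close>

lemma phi_inject:
  fixes P P' :: "'k::field^2^2"
  assumes eq: "phi x y l P = phi x' y' l' P'" and inv: "invertible P" "invertible P'"
  shows "x = x' \<and> y = y' \<and> l = l' \<and> P = P'"
proof -
  have xy: "x = x' \<and> y = y'"
    using fun_cong[OF eq, of "Blk 1 0 0 0"] by simp
  have P: "P = P'"
    unfolding matrix_eq using fun_cong[OF eq, of "Blk 0 0 _ 0"] by simp
  \<comment> \<open>The row \<open>v v* P\<close> is chosen so that the factor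
    \<open>matrix_inv P\<close> cancels.\<close>
  have "l *s v = l' *s v" for v :: "'k^2"
    using fun_cong[OF eq, of "Blk 0 (v v* P) 0 0"]
    by (simp add: P vector_matrix_mul_assoc invertible_matrix_inv inv)
  then show ?thesis using xy P scalar_eqI by blast
qed

lemma Phi_inj_on: "inj_on Phi (carrier param_group)"
proof (rule inj_onI)
  fix p q :: "(('k::field^2) \<times> ('k^2)) \<times> ('k \<times> ('k^2^2))"
  assume *: "p \<in> carrier param_group" "q \<in> carrier param_group" "Phi p = Phi q"
  obtain x y l P where p: "p = ((x, y), (l, P))" by (metis surj_pair)
  obtain x' y' l' P' where q: "q = ((x', y'), (l', P'))" by (metis surj_pair)
  show "p = q"
    using * phi_inject unfolding p q carrier_param_group Phi.simps by blast
qed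

section \<open>Every automorphism belongs to the family\<close>

primrec corner :: "'k blk \<Rightarrow> 'k" where "corner (Blk \<alpha> x y f) = \<alpha>"

primrec block :: "'k blk \<Rightarrow> 'k^2^2" where "block (Blk \<alpha> x y f) = f"

text \<open>Products of rows with columns vanish in both diagonal blocks, so \<open>corner\<close>
  and \<open>block\<close> are ring homomorphisms; their common kernel is the radical.\<close>

lemma corner_ops [simp]: "corner (r * s) = corner r * corner s" "corner (r - s) = corner r - corner s"
  "corner 0 = 0" for r s :: "'k::field blk"
  by (cases r; cases s; simp add: zero_blk_def)+

lemma block_ops [simp]: "block (r * s) = block r ** block s" "block (r - s) = block r - block s"
  "block 0 = 0" for r s :: "'k::field blk"
  by (cases r; cases s; simp add: zero_blk_def)+

text \<open>The right-hand side uses only the ring structure, so automorphisms preserve it. The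
  elements with zero diagonal blocks form an ideal all of whose elements square to zero.\<close>

lemma radical_iff:
  fixes r :: "'k::field blk"
  shows "corner r = 0 \<and> block r = 0 \<longleftrightarrow> (\<forall>s. (r * s) * (r * s) = 0)"
proof
  assume "corner r = 0 \<and> block r = 0"
  then obtain x y where r: "r = Blk 0 x y 0" by (cases r) auto
  show "\<forall>s. (r * s) * (r * s) = 0"
  proof
    fix s show "(r * s) * (r * s) = 0"
      by (cases s) (simp add: r zero_blk_def matrix_distribs)
  qed
next
  assume sq: "\<forall>s. (r * s) * (r * s) = 0"
  obtain \<alpha> x y f where r: "r = Blk \<alpha> x y f" by (cases r)
  have "\<alpha> = 0"
    using sq[rule_format, of 1] by (simp add: r zero_blk_def)
  moreover have "f $ j $ i = 0" for i j
  proof -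
    \<comment> \<open>Right multiplication by this matrix unit moves column \<open>i\<close> of
      \<open>f\<close> to column \<open>j\<close> and clears the other, so entry (j, j) of the
      square is the square of \<open>f $ j $ i\<close>.\<close>
    let ?E = "\<chi> a b. if a = i \<and> b = j then (1::'k) else 0"
    have "(f ** ?E ** (f ** ?E)) $ j $ j = 0"
      using sq[rule_format, of "Blk 0 0 0 ?E"] by (simp add: r zero_blk_def)
    then show ?thesis
      using exhaust_2[of i] exhaust_2[of j] by (auto simp: matrix_matrix_mult_def sum_2)
  qed
  ultimately show "corner r = 0 \<and> block r = 0"
    by (simp add: r vec_eq_iff)
qed

text \<open>Commuting with the two off-diagonal matrix units already forces equal diagonal entries
  and zeros elsewhere.\<close>

lemma central_matrix_2:
  fixes A :: "'k::field^2^2"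
  assumes "\<And>f. f ** A = A ** f"
  shows "\<exists>c. A = mat c"
proof -
  let ?E = "\<chi> a b. if a = 1 \<and> b = 2 then (1::'k) else 0"
  let ?F = "\<chi> a b. if a = 2 \<and> b = 1 then (1::'k) else 0"
  have "A = mat (A $ 1 $ 1)"
    using assms[of ?E] assms[of ?F]
    by (simp add: vec_eq_iff forall_2 matrix_matrix_mult_def sum_2 mat_def)
  then show ?thesis ..
qed

text \<open>The value found is also that of \<open>phi x y 1 (mat 1)\<close> at the same idempotent,
  so composing \<open>g\<close> with the inverse of that map yields an automorphism fixing the
  idempotent.\<close>

lemma automorphism_idempotent:
  fixes g :: "'k::field blk \<Rightarrow> 'k blk"
  assumes g: "algebra_automorphism scale_blk g"
  shows "\<exists>x y. g (Blk 1 0 0 0) = Blk 1 x y 0"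
proof -
  have bij: "bij g" and mult: "g (r * s) = g r * g s" and add: "g (r + s) = g r + g s" for r s
    using g by (auto simp: algebra_automorphism_def blk.linear_iff_ops)
  have g0: "g 0 = 0" using add[of 0 0] by simp
  have diff: "g (r - s) = g r - g s" for r s
    using add[of "r - s" s] by (simp add: algebra_simps)
  have g0_iff: "g r = 0 \<longleftrightarrow> r = 0" for r
    using bij g0 by (metis bij_pointE)
  have rad: "corner (g r) = 0 \<and> block (g r) = 0 \<longleftrightarrow> corner r = 0 \<and> block r = 0" for r
  proof -
    \<comment> \<open>Surjectivity of \<open>g\<close> allows the test element \<open>s\<close> to
      be written as an image.\<close>
    have "(\<forall>s. (g r * s) * (g r * s) = 0) \<longleftrightarrow> (\<forall>s. (g r * g s) * (g r * g s) = 0)"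
      using bij by (metis bij_pointE)
    also have "\<dots> \<longleftrightarrow> (\<forall>s. (r * s) * (r * s) = 0)"
      by (simp flip: mult add: g0_iff)
    finally show ?thesis by (simp add: radical_iff)
  qed
  let ?e = "Blk 1 0 0 0 :: 'k blk"
  obtain \<alpha> x y f where ge: "g ?e = Blk \<alpha> x y f" by (cases "g ?e")
  have "?e * ?e = ?e" by (simp add: matrix_distribs)
  then have idem: "\<alpha> * \<alpha> = \<alpha>" "f ** f = f"
    using mult[of ?e ?e] by (simp_all add: ge)
  \<comment> \<open>Commutators with \<open>?e\<close> lie in the radical, hence so do their images;
    as \<open>g\<close> is onto, \<open>f\<close> commutes with every matrix.\<close>
  have "A ** f = f ** A" for A
  proof -
    obtain r where r: "g r = Blk 0 0 0 A" using bij by (metis bij_pointE)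
    have "corner (r * ?e - ?e * r) = 0 \<and> block (r * ?e - ?e * r) = 0"
      by simp
    then have "block (g r) ** block (g ?e) - block (g ?e) ** block (g r) = 0"
      using rad by (metis diff mult block_ops(1,2))
    then show ?thesis by (simp add: r ge)
  qed
  then obtain c where c: "f = mat c" using central_matrix_2 by blast
  have "f = 0"
  proof (rule ccontr)
    \<comment> \<open>If \<open>f\<close> were the identity, \<open>?e * n = 0\<close> would kill
      the matrix block of \<open>g n\<close>, and \<open>n * n = 0\<close> kills its corner. Then
      \<open>g n\<close> would be in the radical although \<open>n\<close> is not.\<close>
    define n :: "'k blk" where "n = Blk 0 0 0 (\<chi> a b. if a = 1 \<and> b = 2 then 1 else 0)"
    have n: "?e * n = 0" "n * n = 0" "block n \<noteq> 0"
      by (simp_all add: n_def zero_blk_def vec_eq_iff forall_2 matrix_matrix_mult_def sum_2)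
    assume "f \<noteq> 0"
    then have "f = mat 1"
      using idem(2) by (auto simp: c vec_eq_iff forall_2 matrix_matrix_mult_def sum_2 mat_def)
    moreover have "block (g ?e) ** block (g n) = 0"
      by (metis n(1) mult g0 block_ops(1,3))
    ultimately have "block (g n) = 0" by (simp add: ge)
    moreover have "corner (g n) * corner (g n) = 0"
      by (metis n(2) mult g0 corner_ops(1,3))
    ultimately show False using rad[of n] n(3) by simp
  qed
  \<comment> \<open>The idempotent is outside the radical, and therefore so is its image.\<close>
  moreover have "\<alpha> \<noteq> 0"
    using rad[of ?e] \<open>f = 0\<close> by (simp add: ge)
  then have "\<alpha> = 1" using idem(1) by simp
  ultimately show ?thesis using ge by blast
qed

text \<open>The four blocks are the Peirce components of \<open>?e\<close> and its complement
  \<open>?e'\<close>. Both are fixed by \<open>g\<close>, and each component is cut out by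
  multiplying with them from the two sides.\<close>

lemma automorphism_fixing_idempotent:
  fixes g :: "'k::field blk \<Rightarrow> 'k blk"
  assumes g: "algebra_automorphism scale_blk g" and e: "g (Blk 1 0 0 0) = Blk 1 0 0 0"
  shows "\<exists>l P. l \<noteq> 0 \<and> invertible P \<and> g = phi 0 0 l P"
proof -
  have bij: "bij g" and mult: "g (r * s) = g r * g s" and add: "g (r + s) = g r + g s"
    and scale: "g (scale_blk c r) = scale_blk c (g r)" and one: "g 1 = 1" for c r s
    using g by (auto simp: algebra_automorphism_def blk.linear_iff_ops)
  have g0: "g 0 = 0" using add[of 0 0] by simp
  have inj: "g r = g s \<longleftrightarrow> r = s" for r s
    using bij by (metis bij_pointE)
  let ?e = "Blk 1 0 0 0 :: 'k blk" and ?e' = "Blk 0 0 0 (mat 1) :: 'k blk"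
  have "1 = ?e + ?e'" by (simp add: one_blk_def)
  then have "?e + g ?e' = ?e + ?e'" by (metis add e one)
  then have e': "g ?e' = ?e'" by (rule add_left_imp_eq)
  have "\<exists>x'. g (Blk 0 x 0 0) = Blk 0 x' 0 0" for x
  proof -
    have "Blk 0 x 0 0 = ?e * Blk 0 x 0 0 * ?e'" by simp
    then have "g (Blk 0 x 0 0) = ?e * g (Blk 0 x 0 0) * ?e'" by (metis mult e e')
    then show ?thesis by (cases "g (Blk 0 x 0 0)") simp
  qed
  then obtain T where T: "\<And>x. g (Blk 0 x 0 0) = Blk 0 (T x) 0 0" by metis
  have "\<exists>y'. g (Blk 0 0 y 0) = Blk 0 0 y' 0" for y
  proof -
    have "Blk 0 0 y 0 = ?e' * Blk 0 0 y 0 * ?e" by simp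
    then have "g (Blk 0 0 y 0) = ?e' * g (Blk 0 0 y 0) * ?e" by (metis mult e e')
    then show ?thesis by (cases "g (Blk 0 0 y 0)") simp
  qed
  then obtain S where S: "\<And>y. g (Blk 0 0 y 0) = Blk 0 0 (S y) 0" by metis
  have "\<exists>f'. g (Blk 0 0 0 f) = Blk 0 0 0 f'" for f
  proof -
    have "Blk 0 0 0 f = ?e' * Blk 0 0 0 f * ?e'" by simp
    then have "g (Blk 0 0 0 f) = ?e' * g (Blk 0 0 0 f) * ?e'" by (metis mult e e')
    then show ?thesis by (cases "g (Blk 0 0 0 f)") simp
  qed
  then obtain F where F: "\<And>f. g (Blk 0 0 0 f) = Blk 0 0 0 (F f)" by metis
  \<comment> \<open>\<open>scale_blk\<close> builds the matrix block row by row, so scaling a zero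
    block leaves a term of this form.\<close>
  have zero_fun: "(\<chi> i. 0) = (0 :: 'a::zero^'n)" by (simp add: vec_eq_iff)
  have "T (x + x') = T x + T x'" "T (c *s x) = c *s T x" for x x' c
    using add[of "Blk 0 x 0 0" "Blk 0 x' 0 0"] scale[of c "Blk 0 x 0 0"] by (simp_all add: T zero_fun)
  then have "Vector_Spaces.linear (*s) (*s) T" by unfold_locales
  then have T_eq: "T x = x v* transpose (matrix T)" for x
    by (simp add: matrix_works)
  have "S (x + x') = S x + S x'" "S (c *s x) = c *s S x" for x x' c
    using add[of "Blk 0 0 x 0" "Blk 0 0 x' 0"] scale[of c "Blk 0 0 x 0"] by (simp_all add: S zero_fun)
  then have "Vector_Spaces.linear (*s) (*s) S" by unfold_locales
  then have S_eq: "S x = matrix S *v x" for x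
    by (simp add: matrix_works)
  define P where "P = matrix S"
  define Q where "Q = transpose (matrix T)"
  have "inj S" using inj by (metis S blk.inject injI)
  then have "inj ((*v) P)" by (simp add: inj_def P_def S_eq)
  then have P: "invertible P"
    by (metis invertible_def matrix_left_invertible_injective matrix_left_right_inverse)
  \<comment> \<open>The product of a matrix and a column determines \<open>F\<close> as conjugation
    by \<open>P\<close>.\<close>
  have "P *v (f *v y) = F f *v (P *v y)" for f y
    using mult[of "Blk 0 0 0 f" "Blk 0 0 y 0"] by (simp add: S F S_eq P_def)
  then have "P ** f = F f ** P" for f
    by (simp add: matrix_eq matrix_vector_mul_assoc)
  then have F_eq: "F f = P ** f ** matrix_inv P" for f
    by (simp add: matrix_inv_cancel P)
  \<comment> \<open>The product of a row and a matrix links \<open>Q\<close> to \<open>F\<close>;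
    multiplied by \<open>P\<close> on the right, it makes \<open>Q ** P\<close> central.\<close>
  have "x v* f v* Q = x v* Q v* F f" for f x
    using mult[of "Blk 0 x 0 0" "Blk 0 0 0 f"] by (simp add: T F T_eq Q_def)
  then have "f ** Q = Q ** F f" for f
    by (intro vector_matrix_eqI) (simp add: vector_matrix_mul_assoc)
  then have "f ** Q ** P = Q ** F f ** P" for f by simp
  then have "f ** (Q ** P) = (Q ** P) ** f" for f
    by (simp add: F_eq matrix_mul_assoc matrix_inv_cancel P)
  then obtain l where "Q ** P = mat l" using central_matrix_2 by blast
  then have "Q = mat l ** matrix_inv P" by (metis P matrix_inv_cancel(1))
  then have T_l: "T x = l *s (x v* matrix_inv P)" for x
    by (simp add: T_eq mat_mult_vector scalar_vector_matrix_assoc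
        flip: Q_def vector_matrix_mul_assoc)
  \<comment> \<open>Otherwise the row with all entries 1 would be sent to zero, against
    injectivity.\<close>
  have "l \<noteq> 0"
  proof
    assume "l = 0"
    then have "g (Blk 0 1 0 0) = g 0" by (simp add: T T_l g0 zero_blk_def)
    then show False by (simp add: inj zero_blk_def)
  qed
  moreover have "g = phi 0 0 l P"
  proof
    fix r :: "'k blk"
    obtain \<alpha> x y f where r: "r = Blk \<alpha> x y f" by (cases r)
    have "r = scale_blk \<alpha> ?e + Blk 0 x 0 0 + Blk 0 0 y 0 + Blk 0 0 0 f"
      by (simp add: r zero_fun)
    then have "g r = scale_blk \<alpha> ?e + Blk 0 (T x) 0 0 + Blk 0 0 (S y) 0 + Blk 0 0 0 (F f)"
      by (simp only: add scale e T S F)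
    then show "g r = phi 0 0 l P r"
      by (simp add: r zero_fun T_l S_eq P_def F_eq)
  qed
  ultimately show ?thesis using P by blast
qed

section \<open>Surjectivity of \<open>Phi\<close> and the group isomorphism\<close>

lemma Phi_surj:
  fixes g :: "'k::field blk \<Rightarrow> 'k blk"
  assumes g: "algebra_automorphism scale_blk g"
  shows "g \<in> Phi ` carrier param_group"
proof -
  interpret G: group "param_group :: ((('k^2) \<times> ('k^2)) \<times> ('k \<times> ('k^2^2))) monoid"
    by (rule group_param_group)
  interpret A: group "Aut_algebra (scale_blk :: 'k \<Rightarrow> _)" by (rule blk.group_Aut_algebra)
  obtain x y where xy: "g (Blk 1 0 0 0) = Blk 1 x y 0"
    using automorphism_idempotent[OF g] by blast
  let ?p = "((x, y), (1, mat 1))"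
  have p: "?p \<in> carrier param_group"
    by (simp add: carrier_param_group invertible_mat_1)
  let ?q = "inv\<^bsub>param_group\<^esub> ?p"
  note Phi_inv = Phi_inv[OF p]
  \<comment> \<open>\<open>g\<close> and \<open>Phi ?p\<close> agree at the idempotent, so undoing
    \<open>Phi ?p\<close> after \<open>g\<close> fixes it.\<close>
  have "Phi ?q (g (Blk 1 0 0 0)) = (Phi ?q \<circ> Phi ?p) (Blk 1 0 0 0)"
    by (simp add: xy)
  also have "\<dots> = Blk 1 0 0 0"
    by (simp only: Phi_inv id_apply)
  finally have e: "(Phi ?q \<circ> g) (Blk 1 0 0 0) = Blk 1 0 0 0" by simp
  have "algebra_automorphism scale_blk (Phi ?q \<circ> g)"
    using A.m_closed[of "Phi ?q" g] Phi_automorphism[of ?q] g p by (simp add: Aut_algebra_def)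
  then obtain l P where lP: "l \<noteq> 0" "invertible P" "Phi ?q \<circ> g = Phi ((0, 0), (l, P))"
    using automorphism_fixing_idempotent[of "Phi ?q \<circ> g"] e by (metis Phi.simps)
  then have r: "((0, 0), (l, P)) \<in> carrier param_group"
    by (simp add: carrier_param_group)
  have "g = (Phi ?p \<circ> Phi ?q) \<circ> g"
    by (simp only: Phi_inv id_comp)
  also have "\<dots> = Phi ?p \<circ> Phi ((0, 0), (l, P))"
    by (simp only: comp_assoc lP(3))
  also have "\<dots> = Phi (?p \<otimes>\<^bsub>param_group\<^esub> ((0, 0), (l, P)))"
    using p r by (rule Phi_mult[symmetric])
  finally show ?thesis using p r by blast
qed

lemma Phi_iso: "Phi \<in> iso param_group (Aut_algebra scale_blk)"
proof -
  have "Phi ` carrier param_group = carrier (Aut_algebra scale_blk)"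
    using Phi_surj Phi_automorphism by (auto simp: Aut_algebra_def)
  then show ?thesis
    by (simp add: iso_def bij_betw_def Phi_hom Phi_inj_on)
qed

section \<open>Inner automorphisms\<close>

text \<open>For conjugation by \<open>u\<close> with inverse \<open>v\<close>, the columns give
  \<open>P\<close> = a h and the rows give l P^-1 = b f, where a, f and b, h are the diagonal blocks
  of \<open>u\<close> and \<open>v\<close>. Since f h and a b are identities, f P = a and so l = b a
  = 1.\<close>

lemma phi_inner_iff:
  fixes P :: "'k::field^2^2"
  assumes P: "invertible P"
  shows "phi x1 y1 l P \<in> inner_automorphisms \<longleftrightarrow> l = 1"
proof
  assume "phi x1 y1 l P \<in> inner_automorphisms"
  then obtain u v where uv: "u * v = 1" and conj: "phi x1 y1 l P = (\<lambda>r. v * r * u)"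
    by (auto simp: inner_automorphisms_def)
  obtain a x y f where u: "u = Blk a x y f" by (cases u)
  obtain b p q h where v: "v = Blk b p q h" by (cases v)
  have ab: "a * b = 1" and fh: "f ** h = mat 1"
    using uv by (simp_all add: u v one_blk_def)
  have "P *v w = a *s (h *v w)" for w
    using fun_cong[OF conj, of "Blk 0 0 w 0"] by (simp add: u v)
  then have "(f ** P) *v w = mat a *v w" for w
    using fh by (simp add: mat_mult_vector vector_scalar_commute matrix_vector_mul_assoc
        flip: matrix_vector_mul_assoc[of f P])
  then have fP: "f ** P = mat a" by (simp add: matrix_eq)
  have row: "l *s (w v* matrix_inv P) = b *s (w v* f)" for w
    using fun_cong[OF conj, of "Blk 0 w 0 0"] by (simp add: u v matrix_distribs)
  have "l *s w = 1 *s w" for w :: "'k^2"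
  proof -
    have "l *s w = (l *s (w v* matrix_inv P)) v* P"
      by (simp add: matrix_distribs invertible_matrix_inv P)
    also have "\<dots> = b *s (w v* mat a)"
      by (simp add: row matrix_distribs fP)
    finally show ?thesis
      using ab by (simp add: mat_mult_vector vector_smult_assoc mult.commute)
  qed
  then show "l = 1" by (rule scalar_eqI)
next
  assume l: "l = 1"
  \<comment> \<open>The diagonal blocks are the obvious choice. The idempotent with corner 1 must go
    to \<open>Blk 1 x1 y1 0\<close>, which fixes the row of \<open>?u\<close> and the column of
    \<open>?v\<close>; the other two entries follow from \<open>?u * ?v = 1\<close>.\<close>
  let ?u = "Blk 1 x1 (- (matrix_inv P *v y1)) (matrix_inv P)"
  let ?v = "Blk 1 (- (x1 v* P)) y1 P"
  have neg: "(- z) v* A = - (z v* A)" "A *v (- z) = - (A *v z)" for z and A :: "'k^2^2"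
    using vector_matrix_mult_diff_distrib[of 0 z A] matrix_vector_mult_diff_distrib[of A 0 z]
    by simp_all
  have "?u * ?v = 1" "?v * ?u = 1"
    by (simp_all add: one_blk_def matrix_distribs neg invertible_matrix_inv P)
  moreover have "phi x1 y1 l P = (\<lambda>r. ?v * r * ?u)"
  proof
    fix r
    show "phi x1 y1 l P r = ?v * r * ?u"
      by (cases r) (simp add: l matrix_distribs neg invertible_matrix_inv P)
  qed
  ultimately show "phi x1 y1 l P \<in> inner_automorphisms"
    unfolding inner_automorphisms_def by blast
qed

text \<open>First isomorphism theorem for the map that sends an automorphism to its parameter
  \<lambda>: this is a homomorphism onto the units of the field, and its kernel consists of the
  inner automorphisms by \<open>phi_inner_iff\<close>.\<close>

lemma Out_iso: "Out_algebra (scale_blk :: 'k::field \<Rightarrow> _) \<cong> (mult_group :: 'k monoid)"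
proof -
  let ?A = "Aut_algebra (scale_blk :: 'k \<Rightarrow> _)"
  let ?M = "mult_group :: 'k monoid"
  define scal :: "(('k^2) \<times> ('k^2)) \<times> ('k \<times> ('k^2^2)) \<Rightarrow> 'k" where "scal = (\<lambda>p. fst (snd p))"
  have hom: "scal \<in> hom param_group ?M"
    by (rule homI) (auto simp: scal_def carrier_param_group mult_param_group mult_group_def)
  let ?inv = "inv_into (carrier param_group) Phi"
  have inv: "?inv \<in> iso ?A param_group"
    using group.iso_set_sym[OF group_param_group Phi_iso] .
  let ?h = "scal \<circ> ?inv"
  have h_hom: "?h \<in> hom ?A ?M"
    using inv hom by (auto simp: iso_def intro: hom_compose)
  interpret h: group_hom ?A ?M ?h
    using blk.group_Aut_algebra group_mult_group h_hom
    by (simp add: group_hom_def group_hom_axioms_def)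
  have h_Phi: "?h (Phi p) = scal p" if "p \<in> carrier param_group" for p
    using that by (simp add: Phi_inj_on)
  have carrier_A: "carrier ?A = Phi ` carrier param_group"
    using Phi_iso by (auto simp: iso_def bij_betw_def)
  have "c \<in> ?h ` carrier ?A" if "c \<in> carrier ?M" for c
  proof -
    \<comment> \<open>The automorphism that only scales rows by \<open>c\<close> is a preimage of
      \<open>c\<close>.\<close>
    have p: "((0, 0), (c, mat 1)) \<in> carrier param_group"
      using that by (simp add: carrier_param_group invertible_mat_1 mult_group_def)
    have "c = ?h (Phi ((0, 0), (c, mat 1)))"
      unfolding h_Phi[OF p] by (simp add: scal_def)
    then show ?thesis using p carrier_A by blast
  qed
  then have surj: "?h ` carrier ?A = carrier ?M"
    using h.hom_closed by blast
  have "Phi p \<in> inner_automorphisms \<longleftrightarrow> scal p = 1" if "p \<in> carrier param_group" for p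
    using that by (cases p rule: Phi.cases) (simp add: carrier_param_group scal_def phi_inner_iff)
  moreover have "inner_automorphisms \<subseteq> carrier ?A"
    using blk.inner_automorphisms_normal by (meson normal_imp_subgroup subgroup.subset)
  ultimately have "kernel ?A ?M ?h = inner_automorphisms"
    using h_Phi by (auto simp: kernel_def carrier_A mult_group_def)
  then show ?thesis
    using h.FactGroup_iso[OF surj] by (simp add: Out_algebra_def)
qed

theorem theorem5p1:
  shows "(\<forall>x1 y1 l P. l \<noteq> 0 \<and> invertible P \<longrightarrow>
            algebra_automorphism (scale_blk :: 'k::field \<Rightarrow> 'k blk \<Rightarrow> 'k blk) (phi x1 y1 l P))
       \<and> Phi \<in> iso param_group (Aut_algebra (scale_blk :: 'k \<Rightarrow> 'k blk \<Rightarrow> 'k blk))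
       \<and> (\<forall>x1 y1 (l::'k) P. l \<noteq> 0 \<and> invertible P \<longrightarrow>
            (phi x1 y1 l P \<in> inner_automorphisms \<longleftrightarrow> l = 1))
       \<and> Out_algebra (scale_blk :: 'k \<Rightarrow> 'k blk \<Rightarrow> 'k blk) \<cong> (mult_group :: 'k monoid)"
proof (intro conjI allI impI)
  fix x1 y1 and l :: 'k and P :: "'k^2^2"
  assume "l \<noteq> 0 \<and> invertible P"
  then show "algebra_automorphism scale_blk (phi x1 y1 l P)"
    using Phi_automorphism[of "((x1, y1), (l, P))"] by (simp add: carrier_param_group)
qed (use Phi_iso phi_inner_iff Out_iso in auto)

end
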